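(* Let $G$ be a $\overline{C}$-group. Then the group homomorphism $$\pi\times \mathrm{Ab}\colon A(G)\to G\times \mathbb{Z}^{\mathfrak{C}(G)},\qquad g\mapsto (\pi(g),\mathrm{Ab}(g)),$$ is injective.
   Context: For a group $G$, the structure group of its conjugation quandle is $A(G)=\langle e_a,\ a\in G \mid e_ae_b=e_b e_{b^{-1}ab},\ a,b\in G\rangle$. The set of conjugacy classes of $G$ is $\mathfrak{C}(G)$. For a set $X$, $\mathbb{Z}^{X}$ denotes the free abelian group with basis $(c_x)_{x\in X}$ (direct sum). The homomorphism $\pi\colon A(G)\to G$ is defined by $e_a\mapsto a$, and $\mathrm{Ab}\colon A(G)\to\mathbb{Z}^{\mathfrak{C}(G)}$ (the abelianisation map) by $e_a\mapsto c_{\mathcal{O}}$, where $\mathcal{O}$ is the conjugacy class of $a$. A $\overline{C}$-group is a group $G$ admitting a presentation (a $\overline{C}$-type presentation), with some generator set $\Gamma$, in which every relation is either a conjugation relation $b^{-1}ab=c$ with $a,b,c\in\Gamma$, or a power relation $a^k=1$ with $a\in\Gamma$, $k\ge 2$; there is at most one power relation per conjugacy class of $G$ (i.e., for each conjugacy class $\mathcal{O}$ of $G$, at most one power relation $a^k=1$ has $a\in\mathcal{O}$). *)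

theory Defs
  imports "HOL-Algebra.Free_Abelian_Groups" "HOL-Algebra.Group_Action"
begin

section \<open>Groups given by generators and relations\<close>

text \<open>
  A word over \<open>\<Gamma>\<close> is a list of signed letters: \<open>(x, True)\<close> stands for \<open>x\<close> and
  \<open>(x, False)\<close> for \<open>x\<inverse>\<close>. A relation \<open>u = v\<close> is the pair \<open>(u, v)\<close> of words.
\<close>

type_synonym 'x word = "('x \<times> bool) list"

definition words :: "'x set \<Rightarrow> 'x word set"
  where "words \<Gamma> = lists (\<Gamma> \<times> UNIV)"

inductive_set pres_cong :: "'x set \<Rightarrow> ('x word \<times> 'x word) set \<Rightarrow> ('x word \<times> 'x word) set"
  for \<Gamma> :: "'x set" and R :: "('x word \<times> 'x word) set"
where
  refl: "w \<in> words \<Gamma> \<Longrightarrow> (w, w) \<in> pres_cong \<Gamma> R"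
| sym: "(u, v) \<in> pres_cong \<Gamma> R \<Longrightarrow> (v, u) \<in> pres_cong \<Gamma> R"
| trans: "(u, v) \<in> pres_cong \<Gamma> R \<Longrightarrow> (v, w) \<in> pres_cong \<Gamma> R \<Longrightarrow> (u, w) \<in> pres_cong \<Gamma> R"
| app: "(u, u') \<in> pres_cong \<Gamma> R \<Longrightarrow> (v, v') \<in> pres_cong \<Gamma> R \<Longrightarrow> (u @ v, u' @ v') \<in> pres_cong \<Gamma> R"
| cancel: "x \<in> \<Gamma> \<Longrightarrow> ([(x, s), (x, \<not> s)], []) \<in> pres_cong \<Gamma> R"
| rel: "(u, v) \<in> R \<Longrightarrow> u \<in> words \<Gamma> \<Longrightarrow> v \<in> words \<Gamma> \<Longrightarrow> (u, v) \<in> pres_cong \<Gamma> R"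

definition presented_group :: "'x set \<Rightarrow> ('x word \<times> 'x word) set \<Rightarrow> 'x word set monoid"
  where "presented_group \<Gamma> R =
    \<lparr>carrier = words \<Gamma> // pres_cong \<Gamma> R,
     monoid.mult = (\<lambda>S T. \<Union>u\<in>S. \<Union>v\<in>T. pres_cong \<Gamma> R `` {u @ v}),
     one = pres_cong \<Gamma> R `` {[]}\<rparr>"

definition pres_gen :: "'x set \<Rightarrow> ('x word \<times> 'x word) set \<Rightarrow> 'x \<Rightarrow> 'x word set"
  where "pres_gen \<Gamma> R x = pres_cong \<Gamma> R `` {[(x, True)]}"

definition word_eval :: "('h, 'm) monoid_scheme \<Rightarrow> ('x \<Rightarrow> 'h) \<Rightarrow> 'x word \<Rightarrow> 'h"
  where "word_eval H f w =
    foldr (\<lambda>(x, s) y. (if s then f x else inv\<^bsub>H\<^esub> (f x)) \<otimes>\<^bsub>H\<^esub> y) w \<one>\<^bsub>H\<^esub>"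

text \<open>
  The homomorphism out of a presented group determined by images \<open>f\<close> of the generators.
  The choice of the representative is immaterial as soon as \<open>f\<close> respects the relations;
  see \<open>pres_lift_class\<close>, \<open>pres_lift_hom\<close>, \<open>pres_lift_gen\<close> and \<open>pres_hom_unique\<close>.
\<close>

definition pres_lift :: "('h, 'm) monoid_scheme \<Rightarrow> ('x \<Rightarrow> 'h) \<Rightarrow> 'x word set \<Rightarrow> 'h"
  where "pres_lift H f S = word_eval H f (SOME w. w \<in> S)"

subsection \<open>Basic facts\<close>

lemma words_Nil [simp]: "[] \<in> words \<Gamma>"
  and words_Cons [simp]: "p # w \<in> words \<Gamma> \<longleftrightarrow> fst p \<in> \<Gamma> \<and> w \<in> words \<Gamma>"
  and words_append [simp]: "u @ v \<in> words \<Gamma> \<longleftrightarrow> u \<in> words \<Gamma> \<and> v \<in> words \<Gamma>"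
  by (auto simp: words_def mem_Times_iff)

lemma pres_cong_words: "(u, v) \<in> pres_cong \<Gamma> R \<Longrightarrow> u \<in> words \<Gamma> \<and> v \<in> words \<Gamma>"
  by (induction rule: pres_cong.induct) auto

lemma equiv_pres_cong: "equiv (words \<Gamma>) (pres_cong \<Gamma> R)"
proof (rule equivI)
  show "pres_cong \<Gamma> R \<subseteq> words \<Gamma> \<times> words \<Gamma>"
    by (auto dest: pres_cong_words)
  show "refl_on (words \<Gamma>) (pres_cong \<Gamma> R)"
    by (auto simp: refl_on_def intro: pres_cong.refl)
  show "sym (pres_cong \<Gamma> R)"
    by (rule symI) (rule pres_cong.sym)
  show "trans (pres_cong \<Gamma> R)"
    by (rule transI) (rule pres_cong.trans)
qed

lemma pres_class_eq:
  "u \<in> words \<Gamma> \<Longrightarrow> v \<in> words \<Gamma> \<Longrightarrow>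
    pres_cong \<Gamma> R `` {u} = pres_cong \<Gamma> R `` {v} \<longleftrightarrow> (u, v) \<in> pres_cong \<Gamma> R"
  using eq_equiv_class_iff[OF equiv_pres_cong] by metis

lemma pres_mult_class:
  assumes "u \<in> words \<Gamma>" "v \<in> words \<Gamma>"
  shows "(pres_cong \<Gamma> R `` {u}) \<otimes>\<^bsub>presented_group \<Gamma> R\<^esub> (pres_cong \<Gamma> R `` {v})
    = pres_cong \<Gamma> R `` {u @ v}"
proof -
  have eq: "pres_cong \<Gamma> R `` {u' @ v'} = pres_cong \<Gamma> R `` {u @ v}"
    if "(u, u') \<in> pres_cong \<Gamma> R" "(v, v') \<in> pres_cong \<Gamma> R" for u' v'
    using that pres_cong_words[OF that(1)] pres_cong_words[OF that(2)]
      pres_cong.sym[OF pres_cong.app[OF that]]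
    by (simp add: pres_class_eq)
  have mem: "u \<in> pres_cong \<Gamma> R `` {u}" "v \<in> pres_cong \<Gamma> R `` {v}"
    using assms by (simp_all add: pres_cong.refl)
  have "(\<Union>u'\<in>pres_cong \<Gamma> R `` {u}. \<Union>v'\<in>pres_cong \<Gamma> R `` {v}. pres_cong \<Gamma> R `` {u' @ v'})
      = (\<Union>u'\<in>pres_cong \<Gamma> R `` {u}. \<Union>v'\<in>pres_cong \<Gamma> R `` {v}. pres_cong \<Gamma> R `` {u @ v})"
    by (intro SUP_cong refl eq) auto
  also have "\<dots> = pres_cong \<Gamma> R `` {u @ v}"
    using mem by blast
  finally show ?thesis
    by (simp add: presented_group_def)
qed

lemma pres_carrier_iff:
  "S \<in> carrier (presented_group \<Gamma> R) \<longleftrightarrow> (\<exists>w \<in> words \<Gamma>. S = pres_cong \<Gamma> R `` {w})"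
  by (auto simp: presented_group_def quotient_def)

lemma pres_one: "\<one>\<^bsub>presented_group \<Gamma> R\<^esub> = pres_cong \<Gamma> R `` {[]}"
  by (simp add: presented_group_def)

lemma pres_left_inverse:
  assumes "w \<in> words \<Gamma>"
  shows "\<exists>v \<in> words \<Gamma>. (v @ w, []) \<in> pres_cong \<Gamma> R"
  using assms
proof (induction w)
  case Nil
  have "([] @ [], []) \<in> pres_cong \<Gamma> R" by (simp add: pres_cong.refl)
  then show ?case using words_Nil by blast
next
  case (Cons p w)
  obtain x s where p: "p = (x, s)" by force
  with Cons obtain v where v: "v \<in> words \<Gamma>" "(v @ w, []) \<in> pres_cong \<Gamma> R" by auto
  have x: "x \<in> \<Gamma>" and w: "w \<in> words \<Gamma>" using Cons.prems p by auto
  have "([(x, \<not> s), (x, s)], []) \<in> pres_cong \<Gamma> R"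
    using pres_cong.cancel[OF x, of "\<not> s"] by simp
  then have "([(x, \<not> s), (x, s)] @ w, [] @ w) \<in> pres_cong \<Gamma> R"
    by (rule pres_cong.app) (rule pres_cong.refl[OF w])
  then have "(v @ [(x, \<not> s), (x, s)] @ w, v @ [] @ w) \<in> pres_cong \<Gamma> R"
    by (rule pres_cong.app[OF pres_cong.refl[OF v(1)]])
  then have "((v @ [(x, \<not> s)]) @ p # w, []) \<in> pres_cong \<Gamma> R"
    using pres_cong.trans[OF _ v(2)] p by simp
  then show ?case using v(1) x by (intro bexI[of _ "v @ [(x, \<not> s)]"]) auto
qed

lemma group_presented_group: "group (presented_group \<Gamma> R)"
proof (rule groupI)
  fix S assume "S \<in> carrier (presented_group \<Gamma> R)"
  then obtain w where w: "w \<in> words \<Gamma>" "S = pres_cong \<Gamma> R `` {w}" by (auto simp: pres_carrier_iff)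
  obtain v where v: "v \<in> words \<Gamma>" "(v @ w, []) \<in> pres_cong \<Gamma> R"
    using pres_left_inverse[OF w(1)] by blast
  have "(pres_cong \<Gamma> R `` {v}) \<otimes>\<^bsub>presented_group \<Gamma> R\<^esub> S = \<one>\<^bsub>presented_group \<Gamma> R\<^esub>"
    using v w by (simp add: pres_mult_class pres_one pres_class_eq)
  then show "\<exists>T\<in>carrier (presented_group \<Gamma> R). T \<otimes>\<^bsub>presented_group \<Gamma> R\<^esub> S = \<one>\<^bsub>presented_group \<Gamma> R\<^esub>"
    using v(1) by (intro bexI[of _ "pres_cong \<Gamma> R `` {v}"]) (auto simp: pres_carrier_iff)
next
  fix S T assume "S \<in> carrier (presented_group \<Gamma> R)" "T \<in> carrier (presented_group \<Gamma> R)"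
  then obtain u v where "u \<in> words \<Gamma>" "S = pres_cong \<Gamma> R `` {u}" "v \<in> words \<Gamma>" "T = pres_cong \<Gamma> R `` {v}"
    by (auto simp: pres_carrier_iff)
  then show "S \<otimes>\<^bsub>presented_group \<Gamma> R\<^esub> T \<in> carrier (presented_group \<Gamma> R)"
    unfolding pres_carrier_iff by (intro bexI[of _ "u @ v"]) (simp_all add: pres_mult_class)
next
  show "\<one>\<^bsub>presented_group \<Gamma> R\<^esub> \<in> carrier (presented_group \<Gamma> R)"
    unfolding pres_carrier_iff pres_one by (intro bexI[of _ "[]"]) simp_all
next
  fix S T U assume "S \<in> carrier (presented_group \<Gamma> R)" "T \<in> carrier (presented_group \<Gamma> R)"
    "U \<in> carrier (presented_group \<Gamma> R)"
  then obtain u v w where "u \<in> words \<Gamma>" "S = pres_cong \<Gamma> R `` {u}"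
    "v \<in> words \<Gamma>" "T = pres_cong \<Gamma> R `` {v}" "w \<in> words \<Gamma>" "U = pres_cong \<Gamma> R `` {w}"
    unfolding pres_carrier_iff by metis
  then show "S \<otimes>\<^bsub>presented_group \<Gamma> R\<^esub> T \<otimes>\<^bsub>presented_group \<Gamma> R\<^esub> U
      = S \<otimes>\<^bsub>presented_group \<Gamma> R\<^esub> (T \<otimes>\<^bsub>presented_group \<Gamma> R\<^esub> U)"
    by (simp add: pres_mult_class)
next
  fix S assume "S \<in> carrier (presented_group \<Gamma> R)"
  then obtain u where "u \<in> words \<Gamma>" "S = pres_cong \<Gamma> R `` {u}"
    unfolding pres_carrier_iff by metis
  then show "\<one>\<^bsub>presented_group \<Gamma> R\<^esub> \<otimes>\<^bsub>presented_group \<Gamma> R\<^esub> S = S"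
    by (simp add: pres_mult_class pres_one)
qed

lemma pres_gen_closed: "x \<in> \<Gamma> \<Longrightarrow> pres_gen \<Gamma> R x \<in> carrier (presented_group \<Gamma> R)"
  by (auto simp: pres_gen_def pres_carrier_iff intro!: bexI[of _ "[(x, True)]"])

lemma word_eval_simps [simp]:
  "word_eval H f [] = \<one>\<^bsub>H\<^esub>"
  "word_eval H f ((x, s) # w) = (if s then f x else inv\<^bsub>H\<^esub> (f x)) \<otimes>\<^bsub>H\<^esub> word_eval H f w"
  by (simp_all add: word_eval_def)

context group
begin

lemma word_eval_closed:
  assumes "f \<in> \<Gamma> \<rightarrow> carrier G" "w \<in> words \<Gamma>"
  shows "word_eval G f w \<in> carrier G"
  using assms(2)
proof (induction w)
  case (Cons p w)
  then show ?case using assms(1) by (cases p) auto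
qed simp

lemma word_eval_append:
  assumes "f \<in> \<Gamma> \<rightarrow> carrier G" "u \<in> words \<Gamma>" "v \<in> words \<Gamma>"
  shows "word_eval G f (u @ v) = word_eval G f u \<otimes> word_eval G f v"
  using assms(2)
proof (induction u)
  case Nil
  then show ?case using word_eval_closed[OF assms(1,3)] by simp
next
  case (Cons p u)
  obtain x s where p: "p = (x, s)" by force
  have "f x \<in> carrier G" using assms(1) Cons.prems p by auto
  then show ?case
    using Cons word_eval_closed[OF assms(1), of u] word_eval_closed[OF assms(1,3)]
    by (auto simp: p m_assoc)
qed

lemma word_eval_cong:
  assumes f: "f \<in> \<Gamma> \<rightarrow> carrier G"
    and R: "\<And>u v. (u, v) \<in> R \<Longrightarrow> u \<in> words \<Gamma> \<Longrightarrow> v \<in> words \<Gamma> \<Longrightarrow> word_eval G f u = word_eval G f v"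
    and "(u, v) \<in> pres_cong \<Gamma> R"
  shows "word_eval G f u = word_eval G f v"
  using assms(3)
proof (induction rule: pres_cong.induct)
  case (app u u' v v')
  then show ?case
    using pres_cong_words[OF app.hyps(1)] pres_cong_words[OF app.hyps(2)]
    by (simp add: word_eval_append[OF f])
next
  case (cancel x s)
  then have "f x \<in> carrier G" using f by auto
  then show ?case by simp
qed (use R in auto)

lemma pres_lift_class:
  assumes f: "f \<in> \<Gamma> \<rightarrow> carrier G"
    and R: "\<And>u v. (u, v) \<in> R \<Longrightarrow> u \<in> words \<Gamma> \<Longrightarrow> v \<in> words \<Gamma> \<Longrightarrow> word_eval G f u = word_eval G f v"
    and w: "w \<in> words \<Gamma>"
  shows "pres_lift G f (pres_cong \<Gamma> R `` {w}) = word_eval G f w"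
proof -
  have "w \<in> pres_cong \<Gamma> R `` {w}" using w by (auto intro: pres_cong.refl)
  then have "(SOME v. v \<in> pres_cong \<Gamma> R `` {w}) \<in> pres_cong \<Gamma> R `` {w}" by (rule someI)
  then have "(w, SOME v. v \<in> pres_cong \<Gamma> R `` {w}) \<in> pres_cong \<Gamma> R" by blast
  from word_eval_cong[OF f R this] show ?thesis by (simp add: pres_lift_def)
qed

lemma pres_lift_hom:
  assumes f: "f \<in> \<Gamma> \<rightarrow> carrier G"
    and R: "\<And>u v. (u, v) \<in> R \<Longrightarrow> u \<in> words \<Gamma> \<Longrightarrow> v \<in> words \<Gamma> \<Longrightarrow> word_eval G f u = word_eval G f v"
  shows "pres_lift G f \<in> hom (presented_group \<Gamma> R) G"
proof (rule homI)
  fix S assume "S \<in> carrier (presented_group \<Gamma> R)"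
  then show "pres_lift G f S \<in> carrier G"
    using pres_lift_class[OF f R] word_eval_closed[OF f] by (auto simp: pres_carrier_iff)
next
  fix S T assume "S \<in> carrier (presented_group \<Gamma> R)" "T \<in> carrier (presented_group \<Gamma> R)"
  then obtain u v where uv: "u \<in> words \<Gamma>" "v \<in> words \<Gamma>"
    and S: "S = pres_cong \<Gamma> R `` {u}" and T: "T = pres_cong \<Gamma> R `` {v}"
    by (auto simp: pres_carrier_iff)
  have "pres_lift G f (pres_cong \<Gamma> R `` {u @ v}) = word_eval G f (u @ v)"
    using uv by (intro pres_lift_class[OF f R]) auto
  then show "pres_lift G f (S \<otimes>\<^bsub>presented_group \<Gamma> R\<^esub> T) = pres_lift G f S \<otimes> pres_lift G f T"
    using uv pres_lift_class[OF f R uv(1)] pres_lift_class[OF f R uv(2)]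
    by (simp add: S T pres_mult_class word_eval_append[OF f])
qed

lemma pres_lift_gen:
  assumes f: "f \<in> \<Gamma> \<rightarrow> carrier G"
    and R: "\<And>u v. (u, v) \<in> R \<Longrightarrow> u \<in> words \<Gamma> \<Longrightarrow> v \<in> words \<Gamma> \<Longrightarrow> word_eval G f u = word_eval G f v"
    and x: "x \<in> \<Gamma>"
  shows "pres_lift G f (pres_gen \<Gamma> R x) = f x"
proof -
  have "pres_lift G f (pres_cong \<Gamma> R `` {[(x, True)]}) = word_eval G f [(x, True)]"
    using x by (intro pres_lift_class[OF f R]) auto
  moreover have "f x \<in> carrier G" using f x by auto
  ultimately show ?thesis by (simp add: pres_gen_def)
qed

lemma pres_hom_class:
  assumes h: "h \<in> hom (presented_group \<Gamma> R) G" and w: "w \<in> words \<Gamma>"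
  shows "h (pres_cong \<Gamma> R `` {w}) = word_eval G (\<lambda>x. h (pres_gen \<Gamma> R x)) w"
proof -
  interpret H: group_hom "presented_group \<Gamma> R" G h
    using h group_presented_group is_group by (simp add: group_hom_def group_hom_axioms_def)
  show ?thesis using w
  proof (induction w)
    case Nil
    then show ?case using H.hom_one by (simp add: pres_one)
  next
    case (Cons p w)
    obtain x s where p: "p = (x, s)" by force
    have x: "x \<in> \<Gamma>" and w: "w \<in> words \<Gamma>" using Cons.prems p by auto
    have "(pres_cong \<Gamma> R `` {[(x, False)]}) \<otimes>\<^bsub>presented_group \<Gamma> R\<^esub> pres_gen \<Gamma> R x
        = \<one>\<^bsub>presented_group \<Gamma> R\<^esub>"
      using x pres_cong.cancel[OF x, of False R]
      by (simp add: pres_gen_def pres_mult_class pres_one pres_class_eq)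
    moreover have letter: "pres_cong \<Gamma> R `` {[(x, s)]} \<in> carrier (presented_group \<Gamma> R)" for s
      using x by (auto simp: pres_carrier_iff intro!: bexI[of _ "[(x, s)]"])
    ultimately have "pres_cong \<Gamma> R `` {[(x, False)]} = inv\<^bsub>presented_group \<Gamma> R\<^esub> pres_gen \<Gamma> R x"
      using pres_gen_closed[OF x] by (metis H.G.inv_equality)
    then have "h (pres_cong \<Gamma> R `` {[(x, s)]})
        = (if s then h (pres_gen \<Gamma> R x) else inv (h (pres_gen \<Gamma> R x)))"
      using pres_gen_closed[OF x] by (simp add: pres_gen_def)
    moreover have "pres_cong \<Gamma> R `` {p # w}
        = (pres_cong \<Gamma> R `` {[(x, s)]}) \<otimes>\<^bsub>presented_group \<Gamma> R\<^esub> (pres_cong \<Gamma> R `` {w})"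
      using x w by (simp add: pres_mult_class p)
    moreover have "pres_cong \<Gamma> R `` {w} \<in> carrier (presented_group \<Gamma> R)"
      using w by (auto simp: pres_carrier_iff)
    ultimately show ?case
      using Cons.IH[OF w] letter[of s] by (simp add: p H.hom_mult)
  qed
qed

lemma pres_hom_unique:
  assumes "h \<in> hom (presented_group \<Gamma> R) G" "h' \<in> hom (presented_group \<Gamma> R) G"
    and eq: "\<And>x. x \<in> \<Gamma> \<Longrightarrow> h (pres_gen \<Gamma> R x) = h' (pres_gen \<Gamma> R x)"
    and "S \<in> carrier (presented_group \<Gamma> R)"
  shows "h S = h' S"
proof -
  obtain w where w: "w \<in> words \<Gamma>" and S: "S = pres_cong \<Gamma> R `` {w}"
    using assms(4) by (auto simp: pres_carrier_iff)
  have "word_eval G (\<lambda>x. h (pres_gen \<Gamma> R x)) w = word_eval G (\<lambda>x. h' (pres_gen \<Gamma> R x)) w"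
    using w by (induction w) (auto simp: eq)
  then show ?thesis
    using pres_hom_class[OF assms(1) w] pres_hom_class[OF assms(2) w] by (simp add: S)
qed

end

section \<open>Conjugacy classes\<close>

definition conj_class :: "('a, 'm) monoid_scheme \<Rightarrow> 'a \<Rightarrow> 'a set"
  where "conj_class G a =
    orbit G (\<lambda>g. \<lambda>h \<in> carrier G. g \<otimes>\<^bsub>G\<^esub> h \<otimes>\<^bsub>G\<^esub> inv\<^bsub>G\<^esub> g) a"

definition conj_classes :: "('a, 'm) monoid_scheme \<Rightarrow> 'a set set"
  where "conj_classes G =
    orbits G (carrier G) (\<lambda>g. \<lambda>h \<in> carrier G. g \<otimes>\<^bsub>G\<^esub> h \<otimes>\<^bsub>G\<^esub> inv\<^bsub>G\<^esub> g)"

lemma conj_class_in_conj_classes: "a \<in> carrier G \<Longrightarrow> conj_class G a \<in> conj_classes G"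
  by (auto simp: conj_class_def conj_classes_def orbits_def)

lemma (in group) conj_class_conj:
  assumes "a \<in> carrier G" "b \<in> carrier G"
  shows "conj_class G (inv b \<otimes> a \<otimes> b) = conj_class G a"
proof -
  let ?\<phi> = "\<lambda>g. \<lambda>h \<in> carrier G. g \<otimes> h \<otimes> inv g"
  interpret A: group_action G "carrier G" ?\<phi> by (rule action_by_conjugation)
  let ?c = "inv b \<otimes> a \<otimes> b"
  have c: "?c \<in> carrier G" using assms by simp
  have "?c = ?\<phi> (inv b) a" using assms by simp
  then have ca: "?c \<in> orbit G ?\<phi> a"
    using assms unfolding orbit_def by blast
  then have ac: "a \<in> orbit G ?\<phi> ?c"
    using A.orbit_sym[OF assms(1) c] by blast
  have sub: "orbit G ?\<phi> x \<subseteq> carrier G" if "x \<in> carrier G" for x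
    using that by (auto simp: orbit_def)
  show ?thesis unfolding conj_class_def
    using A.orbit_trans[OF assms(1) c _ ca] A.orbit_trans[OF c assms(1) _ ac]
      sub[OF assms(1)] sub[OF c] by blast
qed

section \<open>The structure group of the conjugation quandle\<close>

definition quandle_rels :: "('a, 'm) monoid_scheme \<Rightarrow> ('a word \<times> 'a word) set"
  where "quandle_rels G =
    {([(a, True), (b, True)], [(b, True), (inv\<^bsub>G\<^esub> b \<otimes>\<^bsub>G\<^esub> a \<otimes>\<^bsub>G\<^esub> b, True)]) | a b.
      a \<in> carrier G \<and> b \<in> carrier G}"

definition structure_group :: "('a, 'm) monoid_scheme \<Rightarrow> 'a word set monoid"
  where "structure_group G = presented_group (carrier G) (quandle_rels G)"

definition structure_gen :: "('a, 'm) monoid_scheme \<Rightarrow> 'a \<Rightarrow> 'a word set"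
  where "structure_gen G a = pres_gen (carrier G) (quandle_rels G) a"

definition proj_hom :: "('a, 'm) monoid_scheme \<Rightarrow> 'a word set \<Rightarrow> 'a"
  where "proj_hom G = pres_lift G (\<lambda>a. a)"

definition ab_hom :: "('a, 'm) monoid_scheme \<Rightarrow> 'a word set \<Rightarrow> ('a set \<Rightarrow>\<^sub>0 int)"
  where "ab_hom G = pres_lift (free_Abelian_group (conj_classes G)) (\<lambda>a. frag_of (conj_class G a))"

context group
begin

lemma proj_hom_respects:
  assumes "(u, v) \<in> quandle_rels G"
  shows "word_eval G (\<lambda>a. a) u = word_eval G (\<lambda>a. a) v"
proof -
  obtain a b where ab: "a \<in> carrier G" "b \<in> carrier G"
    and u: "u = [(a, True), (b, True)]" and v: "v = [(b, True), (inv b \<otimes> a \<otimes> b, True)]"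
    using assms unfolding quandle_rels_def by blast
  have "b \<otimes> (inv b \<otimes> a \<otimes> b) = a \<otimes> b"
    using ab by (metis inv_closed inv_solve_left m_assoc m_closed)
  then show ?thesis using ab by (simp add: u v)
qed

lemma proj_hom_hom: "proj_hom G \<in> hom (structure_group G) G"
  unfolding proj_hom_def structure_group_def by (rule pres_lift_hom) (auto intro: proj_hom_respects)

lemma proj_hom_gen: "a \<in> carrier G \<Longrightarrow> proj_hom G (structure_gen G a) = a"
  unfolding proj_hom_def structure_gen_def
  by (rule pres_lift_gen) (auto intro: proj_hom_respects)

lemma ab_hom_respects:
  assumes "(u, v) \<in> quandle_rels G"
  shows "word_eval (free_Abelian_group (conj_classes G)) (\<lambda>a. frag_of (conj_class G a)) u
    = word_eval (free_Abelian_group (conj_classes G)) (\<lambda>a. frag_of (conj_class G a)) v"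
proof -
  obtain a b where ab: "a \<in> carrier G" "b \<in> carrier G"
    and u: "u = [(a, True), (b, True)]" and v: "v = [(b, True), (inv b \<otimes> a \<otimes> b, True)]"
    using assms unfolding quandle_rels_def by blast
  then show ?thesis by (simp add: conj_class_conj add.commute)
qed

lemma ab_hom_hom: "ab_hom G \<in> hom (structure_group G) (free_Abelian_group (conj_classes G))"
  unfolding ab_hom_def structure_group_def
  by (rule group.pres_lift_hom[OF group_free_Abelian_group])
    (auto intro: ab_hom_respects simp: conj_class_in_conj_classes)

lemma ab_hom_gen:
  "a \<in> carrier G \<Longrightarrow> ab_hom G (structure_gen G a) = frag_of (conj_class G a)"
  unfolding ab_hom_def structure_gen_def
  by (rule group.pres_lift_gen[OF group_free_Abelian_group])
    (auto intro: ab_hom_respects simp: conj_class_in_conj_classes)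

end

section \<open>$\overline{C}$-groups\<close>

text \<open>
  A triple \<open>(a, b, c) \<in> C\<close> encodes the relation \<open>b\<inverse> a b = c\<close>, a pair \<open>(a, k) \<in> P\<close> the
  relation \<open>a\<^sup>k = 1\<close>.
\<close>

definition Cbar_rels :: "('x \<times> 'x \<times> 'x) set \<Rightarrow> ('x \<times> nat) set \<Rightarrow> ('x word \<times> 'x word) set"
  where "Cbar_rels C P =
    {([(b, False), (a, True), (b, True)], [(c, True)]) | a b c. (a, b, c) \<in> C} \<union>
    {(replicate k (a, True), []) | a k. (a, k) \<in> P}"

text \<open>
  The isomorphism \<open>h\<close> identifies the presented group with \<open>G\<close>; the conjugacy class of \<open>G\<close>
  containing a generator \<open>a\<close> is the class of its image. Distinct generators are allowed to
  have the same image in \<open>G\<close>.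
\<close>

definition Cbar_presentation ::
  "('a, 'm) monoid_scheme \<Rightarrow> 'x set \<Rightarrow> ('x \<times> 'x \<times> 'x) set \<Rightarrow> ('x \<times> nat) set \<Rightarrow> ('x word set \<Rightarrow> 'a) \<Rightarrow> bool"
  where "Cbar_presentation G \<Gamma> C P h \<longleftrightarrow>
    C \<subseteq> \<Gamma> \<times> \<Gamma> \<times> \<Gamma> \<and>
    P \<subseteq> \<Gamma> \<times> {2..} \<and>
    h \<in> iso (presented_group \<Gamma> (Cbar_rels C P)) G \<and>
    (\<forall>\<O> \<in> conj_classes G. \<forall>(a, k) \<in> P. \<forall>(b, l) \<in> P.
      h (pres_gen \<Gamma> (Cbar_rels C P) a) \<in> \<O> \<longrightarrow>
      h (pres_gen \<Gamma> (Cbar_rels C P) b) \<in> \<O> \<longrightarrow> (a, k) = (b, l))"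

text \<open>
  The generators are drawn from the type \<open>'x\<close>. HOL cannot quantify over it inside the
  definition, so it is a parameter, left arbitrary wherever the predicate is a hypothesis.
\<close>

definition Cbar_group :: "'x itself \<Rightarrow> ('a, 'm) monoid_scheme \<Rightarrow> bool"
  where "Cbar_group (_ :: 'x itself) G \<longleftrightarrow>
    group G \<and>
    (\<exists>(\<Gamma> :: 'x set) C P h. Cbar_presentation G \<Gamma> C P h)"

end

theory Submission
  imports Defs
begin

text \<open>
  Since \<open>e\<^sub>a g = g e\<^sub>b\<close> with \<open>b = \<pi>(g)\<inverse> a \<pi>(g)\<close>, the kernel of \<open>\<pi>\<close> is central in \<open>A(G)\<close>.
  Let \<open>B\<close> be the subgroup of \<open>A(G)\<close> generated by the \<open>e\<^sub>x\<close> for \<open>x \<in> \<Gamma>\<close>; it maps onto \<open>G\<close>, so each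
  class \<open>\<O>\<close> with representative \<open>r\<close> yields a central element \<open>z\<^sub>\<O> \<in> e\<^sub>r B\<close>. Dividing \<open>g\<close> by the
  product of the \<open>z\<^sub>\<O>\<close> prescribed by \<open>Ab(g)\<close> is a homomorphism \<open>A(G) \<rightarrow> B\<close>, whence the kernel of
  \<open>Ab\<close> lies in \<open>B\<close>. The conjugation relations of the presentation of \<open>G\<close> hold in \<open>B\<close>, and its power
  relations hold modulo the central subgroup \<open>Z\<close> generated by the \<open>e\<^sub>a\<^sup>k\<close>; so \<open>B\<close> meets the kernel
  of \<open>\<pi>\<close> inside \<open>Z\<close>. Finally \<open>Ab\<close> is injective on \<open>Z\<close>, because \<open>Ab(e\<^sub>a\<^sup>k)\<close> is \<open>k\<close> times the class
  of \<open>a\<close> and distinct power relations belong to distinct classes.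
\<close>

section \<open>Evaluating words in a group, exactly and modulo a normal subgroup\<close>

lemma (in group) inv_mult_cancel:
  assumes "x \<in> carrier G" "y \<in> carrier G"
  shows "inv x \<otimes> (x \<otimes> y) = y" "x \<otimes> (inv x \<otimes> y) = y"
  using assms by (simp_all flip: m_assoc)

text \<open>Carries a commutation rule for a generator \<open>h\<close> over to
  \<open>inv h\<close>, the inverse case of inductions over \<open>generate\<close>.\<close>

lemma (in group) inv_intertwine:
  assumes "x \<otimes> h = h \<otimes> y" "x \<in> carrier G" "y \<in> carrier G" "h \<in> carrier G"
  shows "y \<otimes> inv h = inv h \<otimes> x"
proof -
  have "y \<otimes> inv h = inv h \<otimes> (h \<otimes> y) \<otimes> inv h"
    using assms(2-4) by (simp add: inv_mult_cancel)
  also have "\<dots> = inv h \<otimes> x"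
    using assms(2-4) by (simp add: m_assoc flip: assms(1))
  finally show ?thesis .
qed

text \<open>Gives an element of the generated subgroup a word over \<open>\<Gamma>\<close>, and that
  word can then be evaluated in other groups or read in a presented group.\<close>

lemma (in group) generate_eq_word_eval_image:
  assumes f: "f \<in> \<Gamma> \<rightarrow> carrier G"
  shows "generate G (f ` \<Gamma>) = word_eval G f ` words \<Gamma>"
proof (intro equalityI subsetI)
  fix g assume "g \<in> generate G (f ` \<Gamma>)"
  then show "g \<in> word_eval G f ` words \<Gamma>"
  proof (induction rule: generate.induct)
    case one
    have "word_eval G f [] = \<one>" by simp
    then show ?case by (metis imageI words_Nil)
  next
    case (incl g)
    then obtain x where x: "x \<in> \<Gamma>" "g = f x" by blast
    moreover have "f x \<in> carrier G" using f x by blast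
    ultimately have "word_eval G f [(x, True)] = g" by simp
    moreover have "[(x, True)] \<in> words \<Gamma>" using x by simp
    ultimately show ?case by blast
  next
    case (inv g)
    then obtain x where x: "x \<in> \<Gamma>" "g = f x" by blast
    moreover have "f x \<in> carrier G" using f x by blast
    ultimately have "word_eval G f [(x, False)] = inv g" by simp
    moreover have "[(x, False)] \<in> words \<Gamma>" using x by simp
    ultimately show ?case by (metis imageI)
  next
    case (eng g g')
    then obtain u v where "u \<in> words \<Gamma>" "v \<in> words \<Gamma>" "g = word_eval G f u" "g' = word_eval G f v"
      by blast
    then show ?case
      using word_eval_append[OF f, of u v] by (intro image_eqI[of _ _ "u @ v"]) auto
  qed
next
  fix g assume "g \<in> word_eval G f ` words \<Gamma>"
  then obtain w where "w \<in> words \<Gamma>" and g: "g = word_eval G f w" by blast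
  then show "g \<in> generate G (f ` \<Gamma>)"
    unfolding g
  proof (induction w)
    case Nil
    show ?case by (simp add: generate.one)
  next
    case (Cons p w)
    then have "f (fst p) \<in> f ` \<Gamma>" by simp
    then show ?case
      using Cons by (cases p) (auto intro!: generate.eng intro: generate.incl generate.inv)
  qed
qed

lemma (in group_hom) hom_word_eval:
  assumes f: "f \<in> \<Gamma> \<rightarrow> carrier G" and w: "w \<in> words \<Gamma>"
  shows "h (word_eval G f w) = word_eval H (\<lambda>x. h (f x)) w"
  using w
proof (induction w)
  case (Cons p w)
  obtain x s where p: "p = (x, s)" by force
  have "f x \<in> carrier G" using f Cons.prems p by auto
  then show ?case
    using Cons G.word_eval_closed[OF f, of w] by (auto simp: p)
qed simp

lemma word_eval_fun_cong:
  assumes "\<And>x. x \<in> \<Gamma> \<Longrightarrow> f x = g x" "w \<in> words \<Gamma>"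
  shows "word_eval H f w = word_eval H g w"
  using assms(2) by (induction w) (auto simp: assms(1))

lemma (in group) word_eval_replicate:
  assumes "f x \<in> carrier G"
  shows "word_eval G f (replicate k (x, True)) = f x [^] k"
proof (induction k)
  case (Suc k)
  then show ?case using assms nat_pow_Suc2[of "f x" k] by (simp del: nat_pow_Suc)
qed simp

text \<open>In the quotient \<open>G Mod Z\<close> the relations hold exactly, so evaluation there
  respects \<open>pres_cong\<close>; the coset map commutes with evaluation.\<close>

lemma (in group) word_eval_cong_mod_normal:
  assumes Z: "Z \<lhd> G" and f: "f \<in> \<Gamma> \<rightarrow> carrier G"
    and R: "\<And>u v. (u, v) \<in> R \<Longrightarrow> u \<in> words \<Gamma> \<Longrightarrow> v \<in> words \<Gamma> \<Longrightarrow>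
      Z #> word_eval G f u = Z #> word_eval G f v"
    and uv: "(u, v) \<in> pres_cong \<Gamma> R"
  shows "Z #> word_eval G f u = Z #> word_eval G f v"
proof -
  interpret q: group_hom G "G Mod Z" "\<lambda>a. Z #> a"
    using normal.factorgroup_is_group[OF Z] normal.r_coset_hom_Mod[OF Z] is_group
    by (simp add: group_hom_def group_hom_axioms_def)
  note q_eval = q.hom_word_eval[OF f]
  have "word_eval (G Mod Z) (\<lambda>x. Z #> f x) u = word_eval (G Mod Z) (\<lambda>x. Z #> f x) v"
  proof (rule q.H.word_eval_cong[OF _ _ uv])
    show "(\<lambda>x. Z #> f x) \<in> \<Gamma> \<rightarrow> carrier (G Mod Z)" using f q.hom_closed by blast
  qed (use R in \<open>simp flip: q_eval\<close>)
  then show ?thesis using pres_cong_words[OF uv] by (simp add: q_eval)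
qed

lemma generate_pres_gen:
  "generate (presented_group \<Gamma> R) (pres_gen \<Gamma> R ` \<Gamma>) = carrier (presented_group \<Gamma> R)"
proof -
  interpret group "presented_group \<Gamma> R" by (rule group_presented_group)
  \<comment> \<open>This is \<open>pres_hom_class\<close> for the identity homomorphism.\<close>
  have "pres_cong \<Gamma> R `` {w} = word_eval (presented_group \<Gamma> R) (pres_gen \<Gamma> R) w"
    if "w \<in> words \<Gamma>" for w
    using pres_hom_class[of "\<lambda>x. x" \<Gamma> R w] that by (simp add: hom_def)
  then have "carrier (presented_group \<Gamma> R) = word_eval (presented_group \<Gamma> R) (pres_gen \<Gamma> R) ` words \<Gamma>"
    by (auto simp: pres_carrier_iff)
  moreover have "pres_gen \<Gamma> R \<in> \<Gamma> \<rightarrow> carrier (presented_group \<Gamma> R)"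
    by (intro funcsetI pres_gen_closed)
  ultimately show ?thesis
    using generate_eq_word_eval_image by metis
qed

section \<open>Free abelian groups mapping to central subgroups, and conjugate elements\<close>

text \<open>The ambient group may be nonabelian, so the universal property is applied to
  \<open>K\<close> as a commutative group of its own, which also keeps the values inside
  \<open>K\<close>.\<close>

lemma (in group) free_Abelian_group_universal_central:
  assumes K: "subgroup K G" and central: "\<And>k g. k \<in> K \<Longrightarrow> g \<in> carrier G \<Longrightarrow> k \<otimes> g = g \<otimes> k"
    and f: "f ` S \<subseteq> K"
  obtains \<tau> where "\<tau> \<in> hom (free_Abelian_group S) G"
    "\<And>n. n \<in> carrier (free_Abelian_group S) \<Longrightarrow> \<tau> n \<in> K" "\<And>x. x \<in> S \<Longrightarrow> \<tau> (frag_of x) = f x"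
proof -
  have KG: "K \<subseteq> carrier G" using K by (rule subgroup.subset)
  have "comm_group (G\<lparr>carrier := K\<rparr>)"
    by (rule group.group_comm_groupI[OF subgroup_imp_group[OF K]]) (use central KG in auto)
  then obtain \<tau> where \<tau>: "\<tau> \<in> hom (free_Abelian_group S) (G\<lparr>carrier := K\<rparr>)"
    "\<And>x. x \<in> S \<Longrightarrow> \<tau> (frag_of x) = f x"
    using comm_group.free_Abelian_group_universal[of "G\<lparr>carrier := K\<rparr>" f S] f by auto
  show ?thesis
    by (rule that[of \<tau>]) (use \<tau> KG in \<open>auto simp: hom_def Pi_def\<close>)
qed

lemma (in group) conj_class_refl:
  assumes "a \<in> carrier G"
  shows "a \<in> conj_class G a"
proof -
  have "(\<lambda>h \<in> carrier G. \<one> \<otimes> h \<otimes> inv \<one>) a = a" using assms by simp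
  then show ?thesis
    unfolding conj_class_def orbit_def by (intro CollectI exI[of _ \<one>] conjI) (simp_all only: one_closed)
qed

lemma (in group) conj_class_eqD:
  assumes "conj_class G a = conj_class G b" "a \<in> carrier G" "b \<in> carrier G"
  obtains y where "y \<in> carrier G" "a = inv y \<otimes> b \<otimes> y"
proof -
  have "a \<in> conj_class G b" using conj_class_refl[OF assms(2)] assms(1) by simp
  then obtain g where "g \<in> carrier G" "a = g \<otimes> b \<otimes> inv g"
    using assms(3) by (auto simp: conj_class_def orbit_def)
  \<comment> \<open>Orbits are taken under \<open>g \<otimes> b \<otimes> inv g\<close>, whereas the
    quandle relations conjugate from the other side; hence the inverse.\<close>
  then show ?thesis using that[of "inv g"] by simp
qed

section \<open>The structure group and the centrality of the kernel of
  \<open>proj_hom\<close>\<close>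

context group
begin

abbreviation "A \<equiv> structure_group G"

lemma group_structure_group: "group A"
  unfolding structure_group_def by (rule group_presented_group)

lemma structure_gen_closed: "a \<in> carrier G \<Longrightarrow> structure_gen G a \<in> carrier A"
  unfolding structure_group_def structure_gen_def by (rule pres_gen_closed)

lemma generate_structure_gen: "generate A (structure_gen G ` carrier G) = carrier A"
  unfolding structure_group_def structure_gen_def by (rule generate_pres_gen)

lemma structure_gen_rel:
  assumes "a \<in> carrier G" "b \<in> carrier G"
  shows "structure_gen G a \<otimes>\<^bsub>A\<^esub> structure_gen G b
    = structure_gen G b \<otimes>\<^bsub>A\<^esub> structure_gen G (inv b \<otimes> a \<otimes> b)"
proof -
  have "([(a, True), (b, True)], [(b, True), (inv b \<otimes> a \<otimes> b, True)])
      \<in> pres_cong (carrier G) (quandle_rels G)"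
    by (rule pres_cong.rel) (use assms in \<open>auto simp: quandle_rels_def\<close>)
  then show ?thesis
    using assms
    by (simp add: structure_group_def structure_gen_def pres_gen_def pres_mult_class pres_class_eq)
qed

lemma group_hom_proj: "group_hom A G (proj_hom G)"
  using group_structure_group proj_hom_hom is_group
  by (simp add: group_hom_def group_hom_axioms_def)

lemma group_hom_ab: "group_hom A (free_Abelian_group (conj_classes G)) (ab_hom G)"
  using group_structure_group ab_hom_hom
  by (simp add: group_hom_def group_hom_axioms_def)

text \<open>The quandle relation is the case of a generator \<open>g\<close>. It spreads to products
  because successive conjugations compose to conjugation by the product of the projections.\<close>

lemma structure_gen_commute:
  assumes g: "g \<in> carrier A" and a: "a \<in> carrier G"
  shows "structure_gen G a \<otimes>\<^bsub>A\<^esub> g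
    = g \<otimes>\<^bsub>A\<^esub> structure_gen G (inv (proj_hom G g) \<otimes> a \<otimes> proj_hom G g)"
proof -
  interpret \<pi>: group_hom A G "proj_hom G" by (rule group_hom_proj)
  have "g \<in> generate A (structure_gen G ` carrier G)"
    using g by (simp add: generate_structure_gen)
  then show ?thesis using a
  proof (induction arbitrary: a rule: generate.induct)
    case one
    then show ?case by (simp add: structure_gen_closed)
  next
    case (incl h)
    then obtain b where "b \<in> carrier G" "h = structure_gen G b" by blast
    then show ?case using structure_gen_rel[OF incl.prems, of b] by (simp add: proj_hom_gen)
  next
    case (inv h)
    then obtain b where b: "b \<in> carrier G" "h = structure_gen G b" by blast
    \<comment> \<open>\<open>c\<close> is the element that \<open>b\<close> conjugates to
      \<open>a\<close>, so inverting the relation for \<open>c\<close> and \<open>b\<close> gives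
      the rule for \<open>a\<close> and \<open>inv h\<close>.\<close>
    define c where "c = b \<otimes> a \<otimes> inv b"
    have c: "c \<in> carrier G" and a': "inv b \<otimes> c \<otimes> b = a"
      using b inv.prems by (simp_all add: c_def m_assoc inv_mult_cancel)
    have "structure_gen G c \<otimes>\<^bsub>A\<^esub> h = h \<otimes>\<^bsub>A\<^esub> structure_gen G a"
      using structure_gen_rel[OF c b(1)] by (simp add: a' b)
    then have "structure_gen G a \<otimes>\<^bsub>A\<^esub> inv\<^bsub>A\<^esub> h = inv\<^bsub>A\<^esub> h \<otimes>\<^bsub>A\<^esub> structure_gen G c"
      by (rule \<pi>.G.inv_intertwine) (use b c inv.prems structure_gen_closed in auto)
    then show ?case using b inv.prems by (simp add: c_def proj_hom_gen structure_gen_closed)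
  next
    case (eng g h)
    have gh: "g \<in> carrier A" "h \<in> carrier A"
      using eng.hyps by (simp_all add: generate_structure_gen)
    let ?p = "proj_hom G g" and ?q = "proj_hom G h"
    let ?a = "inv ?p \<otimes> a \<otimes> ?p"
    have a: "?a \<in> carrier G" and p: "?p \<in> carrier G" "?q \<in> carrier G" using gh eng.prems by auto
    have "structure_gen G a \<otimes>\<^bsub>A\<^esub> (g \<otimes>\<^bsub>A\<^esub> h) = g \<otimes>\<^bsub>A\<^esub> structure_gen G ?a \<otimes>\<^bsub>A\<^esub> h"
      using gh eng.prems by (simp add: eng.IH(1) flip: \<pi>.G.m_assoc add: structure_gen_closed)
    also have "\<dots> = g \<otimes>\<^bsub>A\<^esub> h \<otimes>\<^bsub>A\<^esub> structure_gen G (inv ?q \<otimes> ?a \<otimes> ?q)"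
      using gh a p by (simp add: eng.IH(2) \<pi>.G.m_assoc structure_gen_closed)
    also have "inv ?q \<otimes> ?a \<otimes> ?q = inv (?p \<otimes> ?q) \<otimes> a \<otimes> (?p \<otimes> ?q)"
      using p eng.prems by (simp add: inv_mult_group m_assoc)
    finally show ?case using gh by simp
  qed
qed

text \<open>For trivial \<open>proj_hom G k\<close> the conjugation in
  \<open>structure_gen_commute\<close> disappears: \<open>k\<close> commutes with every generator,
  hence with all they generate.\<close>

lemma kernel_proj_central:
  assumes k: "k \<in> kernel A G (proj_hom G)" and g: "g \<in> carrier A"
  shows "k \<otimes>\<^bsub>A\<^esub> g = g \<otimes>\<^bsub>A\<^esub> k"
proof -
  interpret \<pi>: group_hom A G "proj_hom G" by (rule group_hom_proj)
  have kA: "k \<in> carrier A" and k1: "proj_hom G k = \<one>" using k by (auto simp: kernel_def)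
  have gen: "k \<otimes>\<^bsub>A\<^esub> structure_gen G a = structure_gen G a \<otimes>\<^bsub>A\<^esub> k" if "a \<in> carrier G" for a
    using structure_gen_commute[OF kA that] k1 that by simp
  have "g \<in> generate A (structure_gen G ` carrier G)"
    using g by (simp add: generate_structure_gen)
  then show ?thesis
  proof (induction rule: generate.induct)
    case (inv h)
    then have "h \<in> carrier A" "k \<otimes>\<^bsub>A\<^esub> h = h \<otimes>\<^bsub>A\<^esub> k"
      using gen structure_gen_closed by auto
    then show ?case
      using kA \<pi>.G.inv_intertwine by blast
  next
    case (eng g h)
    then have "g \<in> carrier A" "h \<in> carrier A" by (simp_all add: generate_structure_gen)
    then show ?case using eng.IH kA by (metis \<pi>.G.m_assoc)
  qed (use kA gen in auto)
qed

section \<open>The kernel of \<open>ab_hom\<close> and lifted generating sets\<close>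

lemma ab_hom_kernel_le_generate:
  assumes X: "X \<subseteq> carrier G" "generate G X = carrier G"
    and g: "g \<in> carrier A" "ab_hom G g = 0"
  shows "g \<in> generate A (structure_gen G ` X)"
proof -
  interpret \<pi>: group_hom A G "proj_hom G" by (rule group_hom_proj)
  interpret ab: group_hom A "free_Abelian_group (conj_classes G)" "ab_hom G" by (rule group_hom_ab)
  let ?e = "structure_gen G" and ?K = "kernel A G (proj_hom G)"
  define B where "B = generate A (?e ` X)"
  have eX: "?e ` X \<subseteq> carrier A" using X(1) structure_gen_closed by auto
  have B: "subgroup B A" unfolding B_def by (rule \<pi>.G.generate_is_subgroup[OF eX])
  have BA: "b \<in> carrier A" if "b \<in> B" for b using that subgroup.subset[OF B] by blast
  have "proj_hom G ` ?e ` X = X" using X(1) proj_hom_gen by (force simp: image_image)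
  then have "proj_hom G ` B = carrier G"
    unfolding B_def using \<pi>.generate_img[OF eX] X(2) by simp
  then have lift: "\<exists>b\<in>B. proj_hom G b = y" if "y \<in> carrier G" for y
    using that by (metis imageE)
  \<comment> \<open>Each class gets a representative \<open>r\<close> and a preimage
    \<open>b\<close> of it in \<open>B\<close>.\<close>
  have "\<forall>\<O>\<in>conj_classes G. \<exists>r b. r \<in> carrier G \<and> conj_class G r = \<O> \<and> b \<in> B \<and> proj_hom G b = r"
    using lift by (fastforce simp: conj_classes_def conj_class_def orbits_def)
  then obtain r b where rb: "\<And>\<O>. \<O> \<in> conj_classes G \<Longrightarrow>
      r \<O> \<in> carrier G \<and> conj_class G (r \<O>) = \<O> \<and> b \<O> \<in> B \<and> proj_hom G (b \<O>) = r \<O>"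
    by metis
  define z where "z \<O> = ?e (r \<O>) \<otimes>\<^bsub>A\<^esub> inv\<^bsub>A\<^esub> (b \<O>)" for \<O>
  \<comment> \<open>Both factors of \<open>z \<O>\<close> have projections that cancel, namely
    \<open>r \<O>\<close> and its inverse.\<close>
  have zK: "z ` conj_classes G \<subseteq> ?K"
    using rb BA by (auto simp: z_def kernel_def structure_gen_closed proj_hom_gen)
  obtain \<tau> where \<tau>: "\<tau> \<in> hom (free_Abelian_group (conj_classes G)) A"
      "\<And>n. n \<in> carrier (free_Abelian_group (conj_classes G)) \<Longrightarrow> \<tau> n \<in> ?K"
      "\<And>\<O>. \<O> \<in> conj_classes G \<Longrightarrow> \<tau> (frag_of \<O>) = z \<O>"
    using \<pi>.G.free_Abelian_group_universal_central[OF \<pi>.subgroup_kernel kernel_proj_central zK] by metis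
  interpret \<tau>: group_hom "free_Abelian_group (conj_classes G)" A \<tau>
    using \<tau>(1) \<pi>.G.is_group by (simp add: group_hom_def group_hom_axioms_def)
  \<comment> \<open>Centrality of the values of \<open>\<tau>\<close> makes \<open>\<phi>\<close>
    multiplicative even though the structure group may be nonabelian.\<close>
  define \<phi> where "\<phi> g = inv\<^bsub>A\<^esub> (\<tau> (ab_hom G g)) \<otimes>\<^bsub>A\<^esub> g" for g
  have \<phi>_hom: "\<phi> \<in> hom A A"
  proof (rule homI)
    fix g h assume gh: "g \<in> carrier A" "h \<in> carrier A"
    let ?s = "\<tau> (ab_hom G g)" and ?t = "\<tau> (ab_hom G h)"
    have st: "?s \<in> ?K" "?t \<in> ?K" using gh by (auto intro!: \<tau>(2) ab.hom_closed simp del: carrier_free_Abelian_group_iff)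
    have sA: "?s \<in> carrier A" "?t \<in> carrier A" using st by (auto simp: kernel_def)
    have "inv\<^bsub>A\<^esub> ?t \<in> ?K" using \<pi>.subgroup_kernel st(2) by (rule subgroup.m_inv_closed)
    then have c: "inv\<^bsub>A\<^esub> ?t \<otimes>\<^bsub>A\<^esub> g = g \<otimes>\<^bsub>A\<^esub> inv\<^bsub>A\<^esub> ?t" using gh by (intro kernel_proj_central)
    have "\<tau> (ab_hom G (g \<otimes>\<^bsub>A\<^esub> h)) = ?s \<otimes>\<^bsub>A\<^esub> ?t"
      using gh \<tau>.hom_mult[OF ab.hom_closed ab.hom_closed] by simp
    also have "\<dots> = ?t \<otimes>\<^bsub>A\<^esub> ?s" using st sA by (intro kernel_proj_central)
    finally have "\<phi> (g \<otimes>\<^bsub>A\<^esub> h) = inv\<^bsub>A\<^esub> ?s \<otimes>\<^bsub>A\<^esub> inv\<^bsub>A\<^esub> ?t \<otimes>\<^bsub>A\<^esub> (g \<otimes>\<^bsub>A\<^esub> h)"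
      using sA by (simp add: \<phi>_def \<pi>.G.inv_mult_group)
    also have "\<dots> = inv\<^bsub>A\<^esub> ?s \<otimes>\<^bsub>A\<^esub> (inv\<^bsub>A\<^esub> ?t \<otimes>\<^bsub>A\<^esub> g) \<otimes>\<^bsub>A\<^esub> h"
      using sA gh by (simp add: \<pi>.G.m_assoc)
    also have "\<dots> = \<phi> g \<otimes>\<^bsub>A\<^esub> \<phi> h"
      unfolding c \<phi>_def using sA gh by (simp add: \<pi>.G.m_assoc)
    finally show "\<phi> (g \<otimes>\<^bsub>A\<^esub> h) = \<phi> g \<otimes>\<^bsub>A\<^esub> \<phi> h" .
  qed (auto simp: \<phi>_def simp del: carrier_free_Abelian_group_iff)
  interpret \<phi>: group_hom A A \<phi>
    using \<phi>_hom \<pi>.G.is_group by (simp add: group_hom_def group_hom_axioms_def)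
  \<comment> \<open>With \<open>d\<close> in \<open>B\<close> over an element conjugating
    \<open>r ?O\<close> to \<open>a\<close>, conjugation by \<open>d\<close> shows that
    \<open>?e a\<close> is \<open>z ?O\<close> times an element of \<open>B\<close>;
    \<open>\<phi>\<close> removes the factor \<open>z ?O\<close>.\<close>
  have gen: "\<phi> (?e a) \<in> B" if a: "a \<in> carrier G" for a
  proof -
    let ?O = "conj_class G a"
    have O: "?O \<in> conj_classes G" using a by (rule conj_class_in_conj_classes)
    then obtain y where y: "y \<in> carrier G" "a = inv y \<otimes> r ?O \<otimes> y"
      using conj_class_eqD[of a "r ?O"] rb a by metis
    obtain d where d: "d \<in> B" "proj_hom G d = y" using lift y by blast
    have dA: "d \<in> carrier A" "b ?O \<in> carrier A" "?e (r ?O) \<in> carrier A" "?e a \<in> carrier A"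
      using BA d rb O a by (auto simp: structure_gen_closed)
    have zO: "z ?O \<in> ?K" "z ?O \<in> carrier A" using zK O by (auto simp: kernel_def)
    have "z ?O \<otimes>\<^bsub>A\<^esub> (b ?O \<otimes>\<^bsub>A\<^esub> d) = ?e (r ?O) \<otimes>\<^bsub>A\<^esub> d"
      using dA by (simp add: z_def \<pi>.G.m_assoc \<pi>.G.inv_mult_cancel)
    also have "\<dots> = d \<otimes>\<^bsub>A\<^esub> ?e a"
      using structure_gen_commute[OF dA(1), of "r ?O"] rb[OF O] d(2) y(2) by simp
    finally have "?e a = inv\<^bsub>A\<^esub> d \<otimes>\<^bsub>A\<^esub> (z ?O \<otimes>\<^bsub>A\<^esub> (b ?O \<otimes>\<^bsub>A\<^esub> d))"
      using dA by (simp add: \<pi>.G.inv_mult_cancel)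
    also have "\<dots> = z ?O \<otimes>\<^bsub>A\<^esub> (inv\<^bsub>A\<^esub> d \<otimes>\<^bsub>A\<^esub> (b ?O \<otimes>\<^bsub>A\<^esub> d))"
      using dA zO kernel_proj_central[OF zO(1), of "inv\<^bsub>A\<^esub> d"] by (simp flip: \<pi>.G.m_assoc)
    finally have e: "?e a = z ?O \<otimes>\<^bsub>A\<^esub> (inv\<^bsub>A\<^esub> d \<otimes>\<^bsub>A\<^esub> (b ?O \<otimes>\<^bsub>A\<^esub> d))" .
    have "\<phi> (?e a) = inv\<^bsub>A\<^esub> (z ?O) \<otimes>\<^bsub>A\<^esub> ?e a"
      using a O by (simp add: \<phi>_def ab_hom_gen \<tau>(3))
    also have "\<dots> = inv\<^bsub>A\<^esub> d \<otimes>\<^bsub>A\<^esub> (b ?O \<otimes>\<^bsub>A\<^esub> d)"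
      unfolding e using dA zO by (simp add: \<pi>.G.inv_mult_cancel)
    finally have "\<phi> (?e a) = inv\<^bsub>A\<^esub> d \<otimes>\<^bsub>A\<^esub> (b ?O \<otimes>\<^bsub>A\<^esub> d)" .
    then show ?thesis
      using B d rb[OF O] by (simp add: subgroup.m_closed subgroup.m_inv_closed)
  qed
  have "\<phi> ` carrier A = generate A (\<phi> ` ?e ` carrier G)"
    using structure_gen_closed \<phi>.generate_img[of "?e ` carrier G"] by (auto simp: generate_structure_gen)
  also have "\<dots> \<subseteq> B" using gen by (intro \<pi>.G.generate_subgroup_incl[OF _ B]) auto
  finally have "\<phi> g \<in> B" using g by blast
  \<comment> \<open>As \<open>ab_hom G g = 0\<close>, the divisor \<open>\<tau> (ab_hom G g)\<close>
    is the unit.\<close>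
  moreover have "\<phi> g = g" using g \<tau>.hom_one by (simp add: \<phi>_def)
  ultimately show ?thesis by (simp add: B_def)
qed

section \<open>Lifting the relations of the presentation to the structure group\<close>

lemma Cbar_presentation_kernel_trivial:
  assumes pres: "Cbar_presentation G \<Gamma> C P h"
    and g: "g \<in> carrier A" "proj_hom G g = \<one>" "ab_hom G g = 0"
  shows "g = \<one>\<^bsub>A\<^esub>"
proof -
  let ?K = "kernel A G (proj_hom G)" and ?R = "Cbar_rels C P"
  interpret \<pi>: group_hom A G "proj_hom G" by (rule group_hom_proj)
  interpret ab: group_hom A "free_Abelian_group (conj_classes G)" "ab_hom G" by (rule group_hom_ab)
  have C: "C \<subseteq> \<Gamma> \<times> \<Gamma> \<times> \<Gamma>" and P: "P \<subseteq> \<Gamma> \<times> {2..}"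
    and h: "h \<in> iso (presented_group \<Gamma> ?R) G"
    using pres by (auto simp: Cbar_presentation_def)
  interpret h: group_hom "presented_group \<Gamma> ?R" G h
    using h group_presented_group is_group by (simp add: group_hom_def group_hom_axioms_def iso_def)
  \<comment> \<open>\<open>x\<close> gives the values of the generators in \<open>G\<close>;
    \<open>f\<close> lifts \<open>x\<close> through \<open>proj_hom G\<close>.\<close>
  define x where "x \<gamma> = h (pres_gen \<Gamma> ?R \<gamma>)" for \<gamma>
  define f where "f \<gamma> = structure_gen G (x \<gamma>)" for \<gamma>
  have x: "x \<in> \<Gamma> \<rightarrow> carrier G" unfolding x_def by (intro funcsetI h.hom_closed pres_gen_closed)
  have f: "f \<in> \<Gamma> \<rightarrow> carrier A" unfolding f_def using x by (intro funcsetI structure_gen_closed) auto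
  have xc: "x \<gamma> \<in> carrier G" and fc: "f \<gamma> \<in> carrier A" if "\<gamma> \<in> \<Gamma>" for \<gamma>
    using that x f by auto
  have P_gen: "fst p \<in> \<Gamma>" if "p \<in> P" for p
    using that P by auto
  \<comment> \<open>The uniqueness clause of the presentation is instantiated at the class of
    \<open>x (fst p)\<close>, which contains both values.\<close>
  have P_unique: "p = q" if "p \<in> P" "q \<in> P" "conj_class G (x (fst p)) = conj_class G (x (fst q))" for p q
  proof -
    have xpq: "x (fst p) \<in> carrier G" "x (fst q) \<in> carrier G" using that(1,2) P_gen xc by blast+
    have mem: "x (fst p) \<in> conj_class G (x (fst p))" "x (fst q) \<in> conj_class G (x (fst p))"
      using xpq that(3) conj_class_refl by auto
    have "\<forall>\<O>\<in>conj_classes G. \<forall>(a, k)\<in>P. \<forall>(b, l)\<in>P.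
        x a \<in> \<O> \<longrightarrow> x b \<in> \<O> \<longrightarrow> (a, k) = (b, l)"
      using pres unfolding Cbar_presentation_def x_def by (elim conjE)
    note bspec[OF bspec[OF this conj_class_in_conj_classes[OF xpq(1)]] that(1), unfolded case_prod_beta]
    from bspec[OF this that(2)] show ?thesis using mem by (simp only: prod.collapse simp_thms)
  qed
  have h_class: "h (pres_cong \<Gamma> ?R `` {w}) = word_eval G x w" if "w \<in> words \<Gamma>" for w
    using pres_hom_class[OF h.homh that] by (simp add: x_def[abs_def])
  have rel: "word_eval G x u = word_eval G x v" if "(u, v) \<in> ?R" "u \<in> words \<Gamma>" "v \<in> words \<Gamma>" for u v
    using that h_class pres_class_eq[of u \<Gamma> v ?R] pres_cong.rel[of u v ?R \<Gamma>] by metis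
  have gen: "generate G (x ` \<Gamma>) = carrier G"
  proof -
    have "generate G (x ` \<Gamma>) = generate G (h ` pres_gen \<Gamma> ?R ` \<Gamma>)"
      by (simp add: x_def image_image)
    also have "\<dots> = h ` generate (presented_group \<Gamma> ?R) (pres_gen \<Gamma> ?R ` \<Gamma>)"
      by (rule h.generate_img) (auto simp: pres_gen_closed)
    finally show ?thesis
      using h by (simp add: generate_pres_gen iso_def bij_betw_def)
  qed
  \<comment> \<open>\<open>t\<close> lifts the left sides of the power relations. These relations
    hold in \<open>G\<close>, so the lifts lie in the central kernel of
    \<open>proj_hom G\<close>.\<close>
  define t where "t = (\<lambda>(a, k). f a [^]\<^bsub>A\<^esub> (k :: nat))"
  have tK: "t ` P \<subseteq> ?K"
  proof clarify
    fix a k assume ak: "(a, k) \<in> P"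
    then have a: "a \<in> \<Gamma>" using P_gen by force
    then have xa: "x a \<in> carrier G" "f a \<in> carrier A" using xc fc by blast+
    have "(replicate k (a, True), []) \<in> ?R" using ak unfolding Cbar_rels_def by blast
    moreover have "replicate k (a, True) \<in> words \<Gamma>" using a by (induction k) auto
    ultimately have "x a [^] k = \<one>"
      using rel[of "replicate k (a, True)" "[]"] xa(1) by (simp add: word_eval_replicate)
    moreover have "proj_hom G (f a) = x a" using xa(1) by (simp add: f_def proj_hom_gen)
    ultimately have "proj_hom G (t (a, k)) = \<one>"
      using \<pi>.hom_nat_pow[OF xa(2), of k] by (simp add: t_def)
    then show "t (a, k) \<in> ?K"
      using xa(2) by (simp add: t_def kernel_def)
  qed
  obtain \<tau> where \<tau>: "\<tau> \<in> hom (free_Abelian_group P) A"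
      "\<And>n. n \<in> carrier (free_Abelian_group P) \<Longrightarrow> \<tau> n \<in> ?K"
      "\<And>p. p \<in> P \<Longrightarrow> \<tau> (frag_of p) = t p"
    using \<pi>.G.free_Abelian_group_universal_central[OF \<pi>.subgroup_kernel kernel_proj_central tK] by metis
  interpret \<tau>: group_hom "free_Abelian_group P" A \<tau>
    using \<tau>(1) \<pi>.G.is_group by (simp add: group_hom_def group_hom_axioms_def)
  define Z where "Z = \<tau> ` carrier (free_Abelian_group P)"
  have Z: "subgroup Z A" unfolding Z_def by (rule \<tau>.img_is_subgroup)
  have ZK: "Z \<subseteq> ?K" using \<tau>(2) by (auto simp: Z_def)
  have Z_normal: "Z \<lhd> A"
  proof (rule \<pi>.G.normal_invI[OF Z])
    fix g k assume g: "g \<in> carrier A" and k: "k \<in> Z"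
    have kA: "k \<in> carrier A" using subgroup.subset[OF Z] k by blast
    have "g \<otimes>\<^bsub>A\<^esub> k = k \<otimes>\<^bsub>A\<^esub> g" using kernel_proj_central[OF subsetD[OF ZK k] g] by simp
    then have "g \<otimes>\<^bsub>A\<^esub> k \<otimes>\<^bsub>A\<^esub> inv\<^bsub>A\<^esub> g = k" using g kA by (simp add: \<pi>.G.m_assoc)
    then show "g \<otimes>\<^bsub>A\<^esub> k \<otimes>\<^bsub>A\<^esub> inv\<^bsub>A\<^esub> g \<in> Z" using k by simp
  qed
  \<comment> \<open>A conjugation relation lifts exactly, being a quandle relation; the left side of
    a power relation lifts to \<open>t (a, k)\<close>, which the coset of \<open>Z\<close>
    absorbs.\<close>
  have rel_mod: "Z #>\<^bsub>A\<^esub> word_eval A f u = Z #>\<^bsub>A\<^esub> word_eval A f v"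
    if uv: "(u, v) \<in> ?R" "u \<in> words \<Gamma>" "v \<in> words \<Gamma>" for u v
  proof -
    consider a b c where "(a, b, c) \<in> C" "u = [(b, False), (a, True), (b, True)]" "v = [(c, True)]"
      | a k where "(a, k) \<in> P" "u = replicate k (a, True)" "v = []"
      using uv(1) by (auto simp: Cbar_rels_def)
    then show ?thesis
    proof cases
      case 1
      then have abc: "x a \<in> carrier G" "x b \<in> carrier G" "x c \<in> carrier G"
        "f a \<in> carrier A" "f b \<in> carrier A" "f c \<in> carrier A" using C xc fc by blast+
      have "inv (x b) \<otimes> x a \<otimes> x b = x c" using rel[OF uv] 1 abc by (simp add: m_assoc)
      then have "f a \<otimes>\<^bsub>A\<^esub> f b = f b \<otimes>\<^bsub>A\<^esub> f c"
        using structure_gen_rel[OF abc(1,2)] by (simp add: f_def)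
      then show ?thesis using 1 abc by (simp add: \<pi>.G.inv_mult_cancel)
    next
      case 2
      then have fa: "f a \<in> carrier A" using P_gen fc by force
      have "t (a, k) = \<tau> (frag_of (a, k))" using 2 \<tau>(3) by simp
      then have tZ: "t (a, k) \<in> Z" using 2 by (simp add: Z_def)
      then have "Z #>\<^bsub>A\<^esub> t (a, k) = Z"
        using subgroup.subset[OF Z] by (intro \<pi>.G.coset_join2[OF _ Z]) auto
      then show ?thesis
        using 2 fa subgroup.subset[OF Z]
        by (simp add: t_def \<pi>.G.word_eval_replicate \<pi>.G.coset_mult_one)
    qed
  qed
  \<comment> \<open>Distinct power relations have distinct classes, so the coordinate at the class
    of \<open>p\<close> sees only the \<open>p\<close>-component of \<open>n\<close>, scaled by the
    exponent.\<close>
  have coeff: "Poly_Mapping.lookup (ab_hom G (\<tau> n)) (conj_class G (x (fst p)))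
      = int (snd p) * Poly_Mapping.lookup n p"
    if "Poly_Mapping.keys n \<subseteq> P" and p: "p \<in> P" for n p
    using that(1)
  proof (induction n rule: free_Abelian_group_induct[consumes 1, case_names zero diff gen])
    case zero
    show ?case using \<tau>.hom_one ab.hom_one by simp
  next
    case (diff m n)
    have mn: "m \<in> carrier (free_Abelian_group P)" "n \<in> carrier (free_Abelian_group P)"
      using diff by auto
    have "\<tau> (m - n) = \<tau> (m \<otimes>\<^bsub>free_Abelian_group P\<^esub> inv\<^bsub>free_Abelian_group P\<^esub> n)"
      using diff by simp
    also have "\<dots> = \<tau> m \<otimes>\<^bsub>A\<^esub> inv\<^bsub>A\<^esub> \<tau> n"
      using \<tau>.hom_mult[OF mn(1) \<tau>.G.inv_closed[OF mn(2)]] \<tau>.hom_inv[OF mn(2)] by simp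
    finally have "ab_hom G (\<tau> (m - n)) = ab_hom G (\<tau> m) - ab_hom G (\<tau> n)"
      using \<tau>.hom_closed[OF mn(1)] \<tau>.hom_closed[OF mn(2)] ab.hom_closed[OF \<tau>.hom_closed[OF mn(2)]]
      by simp
    then show ?case using diff by (simp add: lookup_minus right_diff_distrib)
  next
    case (gen q)
    obtain a k where q: "q = (a, k)" by force
    have xa: "x a \<in> carrier G" "f a \<in> carrier A" using P_gen[OF gen] q xc fc by auto
    have ab_q: "ab_hom G (\<tau> (frag_of q)) = frag_cmul (int k) (frag_of (conj_class G (x a)))"
      using gen xa by (simp add: \<tau>(3) t_def q ab.hom_nat_pow f_def ab_hom_gen)
    show ?case
    proof (cases "p = q")
      case True
      then show ?thesis unfolding ab_q by (simp add: q)
    next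
      case False
      then have "conj_class G (x (fst p)) \<noteq> conj_class G (x a)"
        using P_unique[OF p gen] by (metis fst_conv q)
      then show ?thesis using False unfolding ab_q by simp
    qed
  qed
  have "g \<in> generate A (structure_gen G ` x ` \<Gamma>)"
    by (rule ab_hom_kernel_le_generate[OF _ gen g(1,3)]) (use x in auto)
  then have "g \<in> generate A (f ` \<Gamma>)" by (simp add: f_def image_image)
  then obtain w where w: "w \<in> words \<Gamma>" "g = word_eval A f w"
    using \<pi>.G.generate_eq_word_eval_image[OF f] by auto
  \<comment> \<open>The word \<open>w\<close> for \<open>g\<close> also evaluates to the unit in
    \<open>G\<close>; injectivity of \<open>h\<close> then makes it trivial in the presented
    group.\<close>
  have "word_eval G x w = word_eval G (\<lambda>\<gamma>. proj_hom G (f \<gamma>)) w"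
    by (rule word_eval_fun_cong[OF _ w(1)]) (simp add: f_def proj_hom_gen xc)
  also have "\<dots> = \<one>" using \<pi>.hom_word_eval[OF f w(1)] g(2) w(2) by simp
  finally have "h (pres_cong \<Gamma> ?R `` {w}) = h (pres_cong \<Gamma> ?R `` {[]})"
    using w(1) by (simp add: h_class)
  moreover have "inj_on h (carrier (presented_group \<Gamma> ?R))"
    using h by (simp add: iso_def bij_betw_def)
  moreover have "pres_cong \<Gamma> ?R `` {w'} \<in> carrier (presented_group \<Gamma> ?R)" if "w' \<in> words \<Gamma>" for w'
    using that pres_carrier_iff by blast
  ultimately have "pres_cong \<Gamma> ?R `` {w} = pres_cong \<Gamma> ?R `` {[]}"
    using w(1) words_Nil by (meson inj_onD)
  then have "(w, []) \<in> pres_cong \<Gamma> ?R" using w(1) by (simp add: pres_class_eq)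
  \<comment> \<open>In the structure group the triviality of \<open>w\<close> survives only modulo
    \<open>Z\<close>.\<close>
  then have "Z #>\<^bsub>A\<^esub> g = Z #>\<^bsub>A\<^esub> word_eval A f []"
    unfolding w(2) by (intro \<pi>.G.word_eval_cong_mod_normal[OF Z_normal f rel_mod])
  then have "g \<in> Z"
    using \<pi>.G.coset_join1[OF _ g(1) Z] subgroup.subset[OF Z] by (simp add: \<pi>.G.coset_mult_one)
  then obtain n where n: "Poly_Mapping.keys n \<subseteq> P" "g = \<tau> n" by (auto simp: Z_def)
  \<comment> \<open>On \<open>P\<close> the exponents are at least 2, hence nonzero, and can be
    cancelled in the integers.\<close>
  have "Poly_Mapping.lookup n p = 0" for p
  proof (cases "p \<in> P")
    case True
    then have "int (snd p) * Poly_Mapping.lookup n p = 0" using coeff[OF n(1) True] g(3) n(2) by simp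
    moreover have "snd p \<noteq> 0" using True P by auto
    ultimately show ?thesis by simp
  next
    case False
    then show ?thesis using n(1) by (auto simp: in_keys_iff)
  qed
  then have "n = 0" by (intro poly_mapping_eqI) simp
  then show ?thesis using n(2) \<tau>.hom_one by simp
qed

end

theorem theorem1:
  fixes G :: "('a, 'm) monoid_scheme"
  assumes "Cbar_group TYPE('x) G"
  shows "(\<lambda>g. (proj_hom G g, ab_hom G g))
    \<in> mon (structure_group G) (G \<times>\<times> free_Abelian_group (conj_classes G))"
proof -
  interpret group G using assms by (simp add: Cbar_group_def)
  obtain \<Gamma> :: "'x set" and C P h where pres: "Cbar_presentation G \<Gamma> C P h"
    using assms by (auto simp: Cbar_group_def)
  have "(\<lambda>g. (proj_hom G g, ab_hom G g))
      \<in> hom (structure_group G) (G \<times>\<times> free_Abelian_group (conj_classes G))"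
    using proj_hom_hom ab_hom_hom by (simp add: hom_def Pi_iff)
  \<comment> \<open>Injectivity reduces to a trivial kernel, and the kernel of the pair is the
    intersection of both kernels.\<close>
  then show ?thesis
    using group_structure_group DirProd_group[OF is_group group_free_Abelian_group]
      Cbar_presentation_kernel_trivial[OF pres]
    by (subst mon_iff_hom_one) auto
qed

end
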